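(* There exists a stochastic deterministic finite-state generator (SDG) such that the process language it generates is not generated by any quantum deterministic finite-state generator (QDG).
   Context: Let $Y$ be a finite alphabet. A stochastic language over $Y$ is given by a word distribution $\Pr: Y^*\to[0,1]$ with $\sum_{w\in Y^L}\Pr(w)=1$ for every $L\ge 1$. It is a process language if it is subword closed (every subword, i.e. contiguous block, of a word of positive probability has positive probability) and $\Pr(w)\ge\Pr(w\sigma)$ for all words $w$ and symbols $\sigma$. A quantum finite-state generator (QG) with $n$ internal states and output alphabet $Y$ consists of an $n\times n$ unitary matrix $U$ and nonzero projection operators $P(y)$, $y\in Y$, that are diagonal with entries $0$ and $1$ in the standard basis of $\mathbb{C}^n$ and satisfy $\sum_{y\in Y}P(y)=\mathbb{1}$. Its transition matrices are $T(y)=UP(y)$. For a word $y^L=y_0\cdots y_{L-1}$ put $T(y^L)=T(y_0)\cdots T(y_{L-1})$. The stochastic language generated by the QG has (asymptotic) word distribution $\Pr(y^L)=\mathrm{tr}\left(T^\dagger(y^L)\,\rho^s\,T(y^L)\right)$, where $\rho^s=\mathbb{1}/n$. A QDG is a QG in which each matrix $T(y)$ has at most one nonzero entry per row. A stochastic finite-state generator (SG) with finite state set $S$ and output alphabet $Y$ consists of nonnegative $|S|\times|S|$ matrices $T(y)$, $y\in Y$, such that $T=\sum_{y}T(y)$ is a stochastic matrix. An SDG is an SG in which each $T(y)$ has at most one nonzero entry per row. It generates the word distribution $\Pr(y^L)=\sum_{i,j}\pi^s_i\,(T(y_0)\cdots T(y_{L-1}))_{ij}$, where $\pi^s$ is a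 stationary probability row vector of $T$, $\pi^sT=\pi^s$ (any one, if there are several). *)

theory Defs
  imports
    "Jordan_Normal_Form.Schur_Decomposition"
    "HOL-Library.Sublist"
begin

text \<open>
  An alphabet is a finite set of letters, and a word distribution is a function on all lists of
  letters that is zero on every list using a letter outside the alphabet. State sets of size
  \<open>n\<close> are \<open>{0..<n}\<close>.
\<close>

definition stochastic_language :: "'a set \<Rightarrow> ('a list \<Rightarrow> real) \<Rightarrow> bool" where
  "stochastic_language Y Pr \<longleftrightarrow>
     finite Y \<and>
     (\<forall>w. set w \<subseteq> Y \<longrightarrow> 0 \<le> Pr w \<and> Pr w \<le> 1) \<and>
     (\<forall>w. \<not> set w \<subseteq> Y \<longrightarrow> Pr w = 0) \<and>
     (\<forall>L\<ge>1. (\<Sum>w\<in>{w. set w \<subseteq> Y \<and> length w = L}. Pr w) = 1)"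

text \<open>\<^const>\<open>sublist\<close> is the relation of being a contiguous block.\<close>

definition process_language :: "'a set \<Rightarrow> ('a list \<Rightarrow> real) \<Rightarrow> bool" where
  "process_language Y Pr \<longleftrightarrow>
     stochastic_language Y Pr \<and>
     (\<forall>v w. sublist v w \<longrightarrow> Pr w > 0 \<longrightarrow> Pr v > 0) \<and>
     (\<forall>w s. set w \<subseteq> Y \<longrightarrow> s \<in> Y \<longrightarrow> Pr (w @ [s]) \<le> Pr w)"

definition letter_sum :: "'a set \<Rightarrow> nat \<Rightarrow> ('a \<Rightarrow> 'b::comm_monoid_add mat) \<Rightarrow> 'b mat" where
  "letter_sum Y n M = mat n n (\<lambda>(i, j). \<Sum>y\<in>Y. M y $$ (i, j))"

fun word_mat :: "nat \<Rightarrow> ('a \<Rightarrow> 'b::semiring_1 mat) \<Rightarrow> 'a list \<Rightarrow> 'b mat" where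
  "word_mat n T [] = 1\<^sub>m n"
| "word_mat n T (y # w) = T y * word_mat n T w"

definition row_deterministic :: "nat \<Rightarrow> 'b::zero mat \<Rightarrow> bool" where
  "row_deterministic n A \<longleftrightarrow> (\<forall>i<n. card {j. j < n \<and> A $$ (i, j) \<noteq> 0} \<le> 1)"

definition stochastic_mat :: "nat \<Rightarrow> real mat \<Rightarrow> bool" where
  "stochastic_mat n A \<longleftrightarrow>
     A \<in> carrier_mat n n \<and>
     (\<forall>i<n. \<forall>j<n. 0 \<le> A $$ (i, j)) \<and>
     (\<forall>i<n. (\<Sum>j<n. A $$ (i, j)) = 1)"

definition SG :: "'a set \<Rightarrow> nat \<Rightarrow> ('a \<Rightarrow> real mat) \<Rightarrow> bool" where
  "SG Y n T \<longleftrightarrow>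
     finite Y \<and> n > 0 \<and>
     (\<forall>y\<in>Y. T y \<in> carrier_mat n n \<and> (\<forall>i<n. \<forall>j<n. 0 \<le> T y $$ (i, j))) \<and>
     stochastic_mat n (letter_sum Y n T)"

definition SDG :: "'a set \<Rightarrow> nat \<Rightarrow> ('a \<Rightarrow> real mat) \<Rightarrow> bool" where
  "SDG Y n T \<longleftrightarrow> SG Y n T \<and> (\<forall>y\<in>Y. row_deterministic n (T y))"

text \<open>Row vectors are matrices with a single row.\<close>

definition stationary :: "'a set \<Rightarrow> nat \<Rightarrow> ('a \<Rightarrow> real mat) \<Rightarrow> real mat \<Rightarrow> bool" where
  "stationary Y n T p \<longleftrightarrow>
     p \<in> carrier_mat 1 n \<and>
     (\<forall>i<n. 0 \<le> p $$ (0, i)) \<and>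
     (\<Sum>i<n. p $$ (0, i)) = 1 \<and>
     p * letter_sum Y n T = p"

text \<open>
  If the transition matrix has several stationary vectors, each of them yields a generated
  distribution.
\<close>

definition SG_generates :: "'a set \<Rightarrow> nat \<Rightarrow> ('a \<Rightarrow> real mat) \<Rightarrow> ('a list \<Rightarrow> real) \<Rightarrow> bool" where
  "SG_generates Y n T Pr \<longleftrightarrow>
     (\<exists>p. stationary Y n T p \<and>
        (\<forall>w. Pr w =
           (if set w \<subseteq> Y then \<Sum>i<n. \<Sum>j<n. p $$ (0, i) * word_mat n T w $$ (i, j) else 0)))"

definition unitary_mat :: "nat \<Rightarrow> complex mat \<Rightarrow> bool" where
  "unitary_mat n U \<longleftrightarrow>
     U \<in> carrier_mat n n \<and> mat_adjoint U * U = 1\<^sub>m n \<and> U * mat_adjoint U = 1\<^sub>m n"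

definition mat_trace :: "'b::comm_monoid_add mat \<Rightarrow> 'b" where
  "mat_trace A = (\<Sum>i<dim_row A. A $$ (i, i))"

definition diagonal_projection :: "nat \<Rightarrow> complex mat \<Rightarrow> bool" where
  "diagonal_projection n A \<longleftrightarrow>
     A \<in> carrier_mat n n \<and> diagonal_mat A \<and> (\<forall>i<n. A $$ (i, i) \<in> {0, 1})"

definition QG :: "'a set \<Rightarrow> nat \<Rightarrow> complex mat \<Rightarrow> ('a \<Rightarrow> complex mat) \<Rightarrow> bool" where
  "QG Y n U P \<longleftrightarrow>
     finite Y \<and> n > 0 \<and> unitary_mat n U \<and>
     (\<forall>y\<in>Y. diagonal_projection n (P y) \<and> P y \<noteq> 0\<^sub>m n n) \<and>
     letter_sum Y n P = 1\<^sub>m n"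

definition QDG :: "'a set \<Rightarrow> nat \<Rightarrow> complex mat \<Rightarrow> ('a \<Rightarrow> complex mat) \<Rightarrow> bool" where
  "QDG Y n U P \<longleftrightarrow> QG Y n U P \<and> (\<forall>y\<in>Y. row_deterministic n (U * P y))"

definition max_mixed :: "nat \<Rightarrow> complex mat" where
  "max_mixed n = (1 / of_nat n) \<cdot>\<^sub>m 1\<^sub>m n"

definition QG_generates ::
    "'a set \<Rightarrow> nat \<Rightarrow> complex mat \<Rightarrow> ('a \<Rightarrow> complex mat) \<Rightarrow> ('a list \<Rightarrow> real) \<Rightarrow> bool" where
  "QG_generates Y n U P Pr \<longleftrightarrow>
     (\<forall>w. complex_of_real (Pr w) =
        (if set w \<subseteq> Y
         then (let T = word_mat n (\<lambda>y. U * P y) w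
               in mat_trace (mat_adjoint T * max_mixed n * T))
         else 0))"

end

theory Submission
  imports
    Defs
    "HOL-Library.Countable_Set"
    "HOL-Analysis.Continuum_Not_Denumerable"
begin

text \<open>
  Since the stationary state of a quantum generator is \<open>1/n\<close> and \<open>U\<close> is unitary, a single letter
  \<open>y\<close> has probability \<open>tr (P y) / n\<close>, which is rational. A biased coin with irrational bias is an
  SDG with one state whose letter probabilities are irrational.
\<close>

lemma mat_adjoint_index:
  assumes "A \<in> carrier_mat m n" "i < n" "j < m"
  shows "mat_adjoint A $$ (i, j) = conjugate (A $$ (j, i))"
  using assms by (auto simp: mat_adjoint_def mat_of_rows_index)

lemma mat_adjoint_carrier [simp]:
  "A \<in> carrier_mat m n \<Longrightarrow> mat_adjoint A \<in> carrier_mat n m"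
  by (auto simp: mat_adjoint_def)

lemma adjoint_mult_diag:
  fixes A :: "complex mat"
  assumes A: "A \<in> carrier_mat m n" and i: "i < n"
  shows "(mat_adjoint A * A) $$ (i, i) = (\<Sum>k<m. cnj (A $$ (k, i)) * A $$ (k, i))"
proof -
  have d: "dim_row (mat_adjoint A) = n" "dim_col (mat_adjoint A) = m"
    using mat_adjoint_carrier[OF A] by auto
  have "(mat_adjoint A * A) $$ (i, i) = (\<Sum>k\<in>{0..<m}. mat_adjoint A $$ (i, k) * A $$ (k, i))"
    using A i d by (auto simp: scalar_prod_def)
  also have "\<dots> = (\<Sum>k<m. cnj (A $$ (k, i)) * A $$ (k, i))"
    using i by (simp add: mat_adjoint_index[OF A] atLeast0LessThan)
  finally show ?thesis .
qed

lemma mult_diagonal_index: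
  fixes A D :: "'a::comm_semiring_0 mat"
  assumes A: "A \<in> carrier_mat m n" and D: "D \<in> carrier_mat n n" "diagonal_mat D"
    and "i < m" "j < n"
  shows "(A * D) $$ (i, j) = A $$ (i, j) * D $$ (j, j)"
proof -
  have "(A * D) $$ (i, j) = (\<Sum>k\<in>{0..<n}. A $$ (i, k) * D $$ (k, j))"
    using assms by (simp add: scalar_prod_def)
  also have "\<dots> = (\<Sum>k\<in>{0..<n}. if k = j then A $$ (i, j) * D $$ (j, j) else 0)"
    using assms by (intro sum.cong) (auto simp: diagonal_mat_def)
  finally show ?thesis
    using \<open>j < n\<close> by simp
qed

lemma mat_trace_smult:
  fixes A :: "'a::semiring_0 mat"
  assumes "A \<in> carrier_mat n n"
  shows "mat_trace (c \<cdot>\<^sub>m A) = c * mat_trace A"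
  using assms by (simp add: mat_trace_def sum_distrib_left)

text \<open>Column \<open>i\<close> of \<open>U * D\<close> is column \<open>i\<close> of
  \<open>U\<close> scaled by \<open>D $$ (i, i)\<close>. The columns of \<open>U\<close> are unit
  vectors, so only the squared modulus of the scalar is left on the diagonal of the Gram
  matrix.\<close>

lemma unitary_diagonal_trace:
  assumes U: "unitary_mat n U" and D: "D \<in> carrier_mat n n" "diagonal_mat D"
  shows "mat_trace (mat_adjoint (U * D) * (U * D)) = (\<Sum>i<n. cnj (D $$ (i, i)) * D $$ (i, i))"
proof -
  have Uc: "U \<in> carrier_mat n n" and U1: "mat_adjoint U * U = 1\<^sub>m n"
    using U by (auto simp: unitary_mat_def)
  have UD: "U * D \<in> carrier_mat n n"
    using Uc D by simp
  have "(mat_adjoint (U * D) * (U * D)) $$ (i, i) = cnj (D $$ (i, i)) * D $$ (i, i)"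
    if i: "i < n" for i
  proof -
    have norm1: "(\<Sum>k<n. cnj (U $$ (k, i)) * U $$ (k, i)) = 1"
      using adjoint_mult_diag[OF Uc i] i U1 by simp
    have "(mat_adjoint (U * D) * (U * D)) $$ (i, i)
        = (\<Sum>k<n. cnj ((U * D) $$ (k, i)) * (U * D) $$ (k, i))"
      by (rule adjoint_mult_diag[OF UD i])
    also have "\<dots> = (\<Sum>k<n. cnj (D $$ (i, i)) * D $$ (i, i)
                             * (cnj (U $$ (k, i)) * U $$ (k, i)))"
      \<comment> \<open>Without the deletion, simp would expand the entries of \<open>U * D\<close>
        into scalar products before \<open>mult_diagonal_index\<close> can apply.\<close>
      using i by (intro sum.cong)
        (auto simp: mult_diagonal_index[OF Uc D] simp del: index_mult_mat(1))
    also have "\<dots> = cnj (D $$ (i, i)) * D $$ (i, i)"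
      by (simp add: norm1 flip: sum_distrib_left)
    finally show ?thesis .
  qed
  moreover have "dim_row (mat_adjoint (U * D) * (U * D)) = n"
    using mat_adjoint_carrier[OF UD] by simp
  ultimately show ?thesis
    by (simp add: mat_trace_def)
qed

text \<open>The trace counts the ones on the diagonal of \<open>P y\<close>, so a letter of
  \<open>Z\<close> has probability rank(\<open>P y\<close>) / \<open>n\<close>. Letters outside
  \<open>Z\<close> are covered too, since in the theorem the quantum alphabet may differ from
  \<open>Y\<close>.\<close>

lemma QG_letter_prob_rational:
  assumes QG: "QG Z n U P" and gen: "QG_generates Z n U P Pr"
  shows "Pr [y] \<in> \<rat>"
proof (cases "y \<in> Z")
  case False
  have "complex_of_real (Pr [y]) = 0"
    using gen[unfolded QG_generates_def, rule_format, of "[y]"] False by simp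
  then show ?thesis by simp
next
  case True
  let ?A = "U * P y"
  have U: "unitary_mat n U" and P: "P y \<in> carrier_mat n n" "diagonal_mat (P y)"
    and P01: "\<And>i. i < n \<Longrightarrow> P y $$ (i, i) \<in> {0, 1}"
    using QG True by (auto simp: QG_def diagonal_projection_def)
  have A: "?A \<in> carrier_mat n n"
    using U P by (auto simp: unitary_mat_def intro: mult_carrier_mat)
  have Ad: "mat_adjoint ?A \<in> carrier_mat n n"
    using A by simp
  have "mat_adjoint ?A * max_mixed n * ?A = (1 / of_nat n) \<cdot>\<^sub>m (mat_adjoint ?A * ?A)"
    unfolding max_mixed_def
    by (subst mult_smult_distrib[OF Ad one_carrier_mat])
      (simp add: right_mult_one_mat[OF Ad] mult_smult_assoc_mat[OF Ad A])
  \<comment> \<open>For a word of one letter, \<open>word_mat\<close> ends in a factor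
    \<open>1\<^sub>m n\<close>, which \<open>right_mult_one_mat\<close> removes.\<close>
  then have "complex_of_real (Pr [y])
      = mat_trace ((1 / of_nat n) \<cdot>\<^sub>m (mat_adjoint ?A * ?A))"
    using gen[unfolded QG_generates_def, rule_format, of "[y]"] True right_mult_one_mat[OF A]
    by (simp add: Let_def)
  also have "\<dots> = (1 / of_nat n) * mat_trace (mat_adjoint ?A * ?A)"
    by (rule mat_trace_smult[OF mult_carrier_mat[OF Ad A]])
  also have "mat_trace (mat_adjoint ?A * ?A) = (\<Sum>i<n. if P y $$ (i, i) = 1 then 1 else 0)"
    unfolding unitary_diagonal_trace[OF U P] by (intro sum.cong) (use P01 in auto)
  also have "\<dots> = of_nat (card {i. i < n \<and> P y $$ (i, i) = 1})"
    by (simp add: sum.If_cases Collect_conj_eq lessThan_def)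
  finally have "complex_of_real (Pr [y])
      = complex_of_real (real (card {i. i < n \<and> P y $$ (i, i) = 1}) / real n)"
    by simp
  then have "Pr [y] = real (card {i. i < n \<and> P y $$ (i, i) = 1}) / real n"
    unfolding of_real_eq_iff .
  then show ?thesis by simp
qed

text \<open>Distributivity: expanding the power picks one letter from each of the \<open>L\<close>
  factors, and these choices are the words of length \<open>L\<close>. This gives the normalisation
  of the i.i.d. distribution.\<close>

lemma sum_prod_list_words:
  fixes q :: "'a \<Rightarrow> 'b::comm_semiring_1"
  shows "(\<Sum>w\<in>{w. set w \<subseteq> Y \<and> length w = L}. prod_list (map q w)) = (\<Sum>y\<in>Y. q y) ^ L"
proof (induction L)
  case 0
  have "{w. set w \<subseteq> Y \<and> length w = 0} = {[]}" by auto
  then show ?case by simp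
next
  case (Suc L)
  \<comment> \<open>A word of length \<open>Suc L\<close> splits uniquely into head and tail, so the
    sum can be reindexed over pairs and factorised.\<close>
  have "inj_on (\<lambda>(w, y). y # w) ({w. set w \<subseteq> Y \<and> length w = L} \<times> Y)"
    by (auto simp: inj_on_def)
  then have "(\<Sum>w\<in>{w. set w \<subseteq> Y \<and> length w = Suc L}. prod_list (map q w))
      = (\<Sum>(w, y)\<in>{w. set w \<subseteq> Y \<and> length w = L} \<times> Y. prod_list (map q w) * q y)"
    unfolding lists_length_Suc_eq
    by (simp add: sum.reindex case_prod_unfold mult.commute)
  then show ?case
    by (simp add: Suc.IH[symmetric] sum_product mult.commute flip: sum.cartesian_product)
      (simp add: sum.swap[of _ Y])
qed

definition iid_prob :: "'a set \<Rightarrow> ('a \<Rightarrow> real) \<Rightarrow> 'a list \<Rightarrow> real" where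
  "iid_prob Y q w = (if set w \<subseteq> Y then prod_list (map q w) else 0)"

lemma prod_list_map_pos:
  fixes q :: "'a \<Rightarrow> real"
  shows "(\<And>y. y \<in> set w \<Longrightarrow> q y > 0) \<Longrightarrow> prod_list (map q w) > 0"
  by (induction w) auto

lemma prod_list_map_le_1:
  fixes q :: "'a \<Rightarrow> real"
  shows "(\<And>y. y \<in> set w \<Longrightarrow> 0 \<le> q y \<and> q y \<le> 1) \<Longrightarrow>
    0 \<le> prod_list (map q w) \<and> prod_list (map q w) \<le> 1"
  by (induction w) (auto intro: mult_le_one)

text \<open>As all weights are strictly positive, the words of positive probability are exactly the
  words over \<open>Y\<close>, a set closed under blocks. Appending a letter multiplies the
  probability by a weight of at most 1.\<close>

lemma process_language_iid:
  assumes fin: "finite Y" and pos: "\<And>y. y \<in> Y \<Longrightarrow> q y > 0" and sum: "(\<Sum>y\<in>Y. q y) = 1"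
  shows "process_language Y (iid_prob Y q)"
proof -
  have q1: "q y \<le> 1" if "y \<in> Y" for y
    using member_le_sum[of y Y q] fin pos sum that by (simp add: less_imp_le)
  have P01: "0 \<le> prod_list (map q w)" "prod_list (map q w) \<le> 1" if "set w \<subseteq> Y" for w
    using prod_list_map_le_1[of w q] pos q1 that by (auto simp: subset_iff less_imp_le)
  have "(\<Sum>w\<in>{w. set w \<subseteq> Y \<and> length w = L}. iid_prob Y q w) = 1" for L
    using sum_prod_list_words[of q Y L] by (simp add: iid_prob_def sum)
  then have "stochastic_language Y (iid_prob Y q)"
    using fin P01 by (auto simp: stochastic_language_def iid_prob_def)
  moreover have "iid_prob Y q v > 0" if "sublist v w" "iid_prob Y q w > 0" for v w
  proof -
    have "set v \<subseteq> Y"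
      using that set_mono_sublist[OF that(1)] by (auto simp: iid_prob_def split: if_splits)
    then show ?thesis
      using pos by (auto simp: iid_prob_def intro!: prod_list_map_pos)
  qed
  moreover have "iid_prob Y q (w @ [s]) \<le> iid_prob Y q w" if "set w \<subseteq> Y" "s \<in> Y" for w s
    using that P01[of w] q1[of s] by (simp add: iid_prob_def mult_left_le)
  ultimately show ?thesis
    by (auto simp: process_language_def)
qed

text \<open>A single state on which each letter is a loop, so matrix products reduce to products of
  scalars.\<close>

definition iid_mat :: "('a \<Rightarrow> real) \<Rightarrow> 'a \<Rightarrow> real mat" where
  "iid_mat q y = mat 1 1 (\<lambda>_. q y)"

lemma word_mat_iid: "word_mat 1 (iid_mat q) w = mat 1 1 (\<lambda>_. prod_list (map q w))"
  by (induction w) (auto simp: iid_mat_def scalar_prod_def intro!: eq_matI)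

lemma letter_sum_iid:
  assumes "(\<Sum>y\<in>Y. q y) = 1"
  shows "letter_sum Y 1 (iid_mat q) = 1\<^sub>m 1"
  using assms by (auto simp: letter_sum_def iid_mat_def intro!: eq_matI)

lemma SDG_iid:
  assumes "finite Y" "\<And>y. y \<in> Y \<Longrightarrow> q y \<ge> 0" "(\<Sum>y\<in>Y. q y) = 1"
  shows "SDG Y 1 (iid_mat q)"
proof -
  have "row_deterministic 1 (iid_mat q y)" for y
    unfolding row_deterministic_def
  proof (intro allI impI)
    fix i
    have "card {j. j < 1 \<and> iid_mat q y $$ (i, j) \<noteq> 0} \<le> card {0::nat}"
      by (intro card_mono) auto
    then show "card {j. j < 1 \<and> iid_mat q y $$ (i, j) \<noteq> 0} \<le> 1"
      by simp
  qed
  then show ?thesis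
    using assms letter_sum_iid[OF assms(3)]
    by (auto simp: SDG_def SG_def stochastic_mat_def iid_mat_def)
qed

text \<open>The transition matrix is the 1 x 1 identity, and normalisation forces the stationary
  vector to be 1. Uniqueness of the generated distribution settles the quantifier over all
  \<open>Pr\<close> in the theorem.\<close>

lemma SG_generates_iid:
  assumes "(\<Sum>y\<in>Y. q y) = 1"
  shows "SG_generates Y 1 (iid_mat q) Pr \<longleftrightarrow> Pr = iid_prob Y q"
proof -
  have *: "stationary Y 1 (iid_mat q) p \<longleftrightarrow> p \<in> carrier_mat 1 1 \<and> p $$ (0, 0) = 1" for p
    unfolding stationary_def letter_sum_iid[OF assms] by auto
  have sum: "(\<Sum>i<1. \<Sum>j<1. p $$ (0, i) * word_mat 1 (iid_mat q) w $$ (i, j))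
      = p $$ (0, 0) * prod_list (map q w)" for p w
    by (simp only: word_mat_iid) simp
  \<comment> \<open>Existence of a stationary vector is what the direction from right to left
    requires.\<close>
  have "\<exists>p::real mat. p \<in> carrier_mat 1 1 \<and> p $$ (0, 0) = 1"
    by (intro exI[of _ "1\<^sub>m 1"]) simp
  then show ?thesis
    unfolding SG_generates_def sum * iid_prob_def fun_eq_iff
    by (auto cong: if_cong conj_cong)
qed

theorem proposition13:
  shows "\<exists>(Y :: nat set) (n :: nat) (T :: nat \<Rightarrow> real mat).
    SDG Y n T \<and>
    (\<exists>Pr. SG_generates Y n T Pr) \<and>
    (\<forall>Pr. SG_generates Y n T Pr \<longrightarrow>
       process_language Y Pr \<and>
       \<not> (\<exists>(Z :: nat set) (m :: nat) (U :: complex mat) (P :: nat \<Rightarrow> complex mat).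
            QDG Z m U P \<and> QG_generates Z m U P Pr))"
proof -
  \<comment> \<open>The rationals are countable, so they cannot exhaust the open interval; its
    bounds make both \<open>a\<close> and \<open>1 - a\<close> positive.\<close>
  have "uncountable {0<..<1::real}"
    by (simp add: uncountable_open_interval)
  then obtain a :: real where a: "0 < a" "a < 1" "a \<notin> \<rat>"
    by (metis countable_rat countable_subset greaterThanLessThan_iff subsetI)
  define Y :: "nat set" where "Y = {0, 1}"
  define q where "q y = (if y = 0 then a else 1 - a)" for y :: nat
  have q: "finite Y" "\<And>y. y \<in> Y \<Longrightarrow> q y > 0" "(\<Sum>y\<in>Y. q y) = 1"
    using a by (auto simp: Y_def q_def)
  \<comment> \<open>The word \<open>[0]\<close> separates the two models: its probability is
    irrational.\<close>
  have "iid_prob Y q [0] = a"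
    by (simp add: iid_prob_def Y_def q_def)
  then have no_QDG: "\<not> (QDG Z m U P \<and> QG_generates Z m U P (iid_prob Y q))" for Z m U P
    using QG_letter_prob_rational[of Z m U P "iid_prob Y q" 0] a by (auto simp: QDG_def)
  have SDG: "SDG Y 1 (iid_mat q)"
    using q by (intro SDG_iid) (auto simp: less_imp_le)
  show ?thesis
    by (intro exI[of _ Y] exI[of _ 1] exI[of _ "iid_mat q"])
      (use SDG process_language_iid[OF q] no_QDG in \<open>simp only: SG_generates_iid[OF q(3)], blast\<close>)
qed

end
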